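(* Let $(M,K,\nu)$ be a Markov system and let $(\mathscr{E},\|\cdot\|_{\mathscr{E}})$ be an admissible space of observables for it, and assume that $(M,K,\nu)$ is strongly mixing on $(\mathscr{E},\|\cdot\|_{\mathscr{E}})$ with mixing rate $\{r_n\}_{n\ge 1}$, $r_n\searrow 0$. Let $\{Z_n\}_{n\ge 0}$ be a $K$-Markov chain. Then for all $\varphi\in\mathscr{E}$ and $\epsilon>0$ there are $c(\epsilon)>0$ and an integer $n(\epsilon)\ge 1$ such that for all $n\ge n(\epsilon)$ and all $x_0\in M$, $$\mathbb{P}_{x_0}\left\{\left|\frac1n S_n\varphi-\int_M\varphi\,d\nu\right|>\epsilon\right\}\le 8\,e^{-c(\epsilon)\,n}.$$ More precisely, for $\varphi\neq 0$, one can take $n(\epsilon)$ to be the first integer $n_0\ge 1$ such that $r_{n_0}\le \frac{\epsilon}{4\|\varphi\|_{\mathscr{E}}}$, and $$c(\epsilon)=\frac{1}{8\,\|\varphi\|_{\mathscr{E}}^2}\,\frac{\epsilon^2}{n(\epsilon)}.$$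
   Context: $M$ is a Polish metric space and $\mathrm{Prob}(M)$ is the set of Borel probability measures on $M$ with the weak topology. A stochastic dynamical system (Markov kernel) is a continuous map $K\colon M\to\mathrm{Prob}(M)$, $x\mapsto K_x$. A measure $\nu\in\mathrm{Prob}(M)$ is $K$-stationary if $\nu(E)=\int_M K_x(E)\,d\nu(x)$ for all Borel $E\subset M$; then $(M,K,\nu)$ is a Markov system. $L^\infty(M)$ is the space of bounded Borel measurable functions on $M$ with $\|\varphi\|_\infty=\sup_{x\in M}|\varphi(x)|$. The Markov operator is $\mathcal{Q}\varphi(x)=\int_M\varphi(y)\,dK_x(y)$ on $L^\infty(M)$. An admissible space of observables is a Banach space $(\mathscr{E},\|\cdot\|_{\mathscr{E}})$ of functions, $\mathscr{E}\subset L^\infty(M)$ a linear subspace containing the constant function $\mathbf 1$, with $\mathcal{Q}(\mathscr{E})\subset\mathscr{E}$, $\|\varphi\|_\infty\le\|\varphi\|_{\mathscr{E}}$ for all $\varphi\in\mathscr{E}$, and $\|\mathcal{Q}\varphi\|_{\mathscr{E}}\le C_0\|\varphi\|_{\mathscr{E}}$ for all $\varphi\in\mathscr{E}$ and some constant $C_0<\infty$. Strongly mixing on $\mathscr{E}$ with mixing rate $\{r_n\}$ (a decreasing sequence of positive reals with $r_n\to0$) means: for all $\varphi\in\mathscr{E}$ and $n\ge1$, $\left\|\mathcal{Q}^n\varphi-\int_M\varphi\,d\nu\right\|_\infty\le r_n\,\|\varphi\|_{\mathscr{E}}$. A $K$-Markov chain $\{Z_n\}_{n\ge0}$ is a Markov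 chain with values in $M$ and transition kernel $K$; $\mathbb{P}_{x_0}$ denotes its law when started at $Z_0=x_0$. $S_n\varphi=\varphi(Z_0)+\cdots+\varphi(Z_{n-1})$. *)

theory Defs
  imports "HOL-Probability.Probability"
begin

text \<open>The space of Borel probability measures is \<open>space (prob_algebra borel)\<close>. Its weak topology is
  the coarsest one making \<open>\<mu> \<mapsto> \<integral> f d\<mu>\<close> continuous for every bounded continuous real \<open>f\<close>.\<close>

definition weak_prob_topology :: "'a::polish_space measure topology" where
  "weak_prob_topology = topology_generated_by
     {{\<mu> \<in> space (prob_algebra borel). (\<integral>x. f x \<partial>\<mu>) \<in> U} | (f :: 'a \<Rightarrow> real) U.
        continuous_on UNIV f \<and> bounded (range f) \<and> open U}"

definition markov_kernel :: "('a::polish_space \<Rightarrow> 'a measure) \<Rightarrow> bool" where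
  "markov_kernel K \<longleftrightarrow> continuous_map euclidean weak_prob_topology K"

definition stationary :: "('a::polish_space \<Rightarrow> 'a measure) \<Rightarrow> 'a measure \<Rightarrow> bool" where
  "stationary K \<nu> \<longleftrightarrow> (\<forall>E\<in>sets borel. measure \<nu> E = (\<integral>x. measure (K x) E \<partial>\<nu>))"

definition markov_system :: "('a::polish_space \<Rightarrow> 'a measure) \<Rightarrow> 'a measure \<Rightarrow> bool" where
  "markov_system K \<nu> \<longleftrightarrow>
     markov_kernel K \<and> \<nu> \<in> space (prob_algebra borel) \<and> stationary K \<nu>"

definition Linf :: "('a::polish_space \<Rightarrow> real) set" where
  "Linf = {\<phi>. \<phi> \<in> borel_measurable borel \<and> bounded (range \<phi>)}"

text \<open>A genuine supremum over all points, not an essential supremum; used only on bounded functions,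
  where \<open>SUP\<close> is meaningful.\<close>

definition sup_norm :: "('a \<Rightarrow> real) \<Rightarrow> real" where
  "sup_norm \<phi> = (SUP x. \<bar>\<phi> x\<bar>)"

definition markov_op :: "('a \<Rightarrow> 'a measure) \<Rightarrow> ('a \<Rightarrow> real) \<Rightarrow> 'a \<Rightarrow> real" where
  "markov_op K \<phi> x = (\<integral>y. \<phi> y \<partial>(K x))"

text \<open>\<open>N\<close> is only meaningful on \<open>E\<close>; its values elsewhere are arbitrary.\<close>

definition banach_function_space :: "('a \<Rightarrow> real) set \<Rightarrow> (('a \<Rightarrow> real) \<Rightarrow> real) \<Rightarrow> bool" where
  "banach_function_space E N \<longleftrightarrow>
     (\<lambda>_. 0) \<in> E \<and>
     (\<forall>f\<in>E. \<forall>g\<in>E. (\<lambda>x. f x + g x) \<in> E) \<and>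
     (\<forall>a. \<forall>f\<in>E. (\<lambda>x. a * f x) \<in> E) \<and>
     (\<forall>f\<in>E. 0 \<le> N f) \<and>
     (\<forall>f\<in>E. N f = 0 \<longleftrightarrow> f = (\<lambda>_. 0)) \<and>
     (\<forall>a. \<forall>f\<in>E. N (\<lambda>x. a * f x) = \<bar>a\<bar> * N f) \<and>
     (\<forall>f\<in>E. \<forall>g\<in>E. N (\<lambda>x. f x + g x) \<le> N f + N g) \<and>
     (\<forall>u. (\<forall>n. u n \<in> E) \<and>
           (\<forall>e>0. \<exists>k. \<forall>m\<ge>k. \<forall>n\<ge>k. N (\<lambda>x. u m x - u n x) < e) \<longrightarrow>
           (\<exists>f\<in>E. (\<lambda>n::nat. N (\<lambda>x. u n x - f x)) \<longlonglongrightarrow> 0))"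

definition admissible ::
    "('a::polish_space \<Rightarrow> 'a measure) \<Rightarrow> ('a \<Rightarrow> real) set \<Rightarrow> (('a \<Rightarrow> real) \<Rightarrow> real) \<Rightarrow> bool" where
  "admissible K E N \<longleftrightarrow>
     banach_function_space E N \<and> E \<subseteq> Linf \<and> (\<lambda>_. 1) \<in> E \<and>
     (\<forall>\<phi>\<in>E. markov_op K \<phi> \<in> E) \<and>
     (\<forall>\<phi>\<in>E. sup_norm \<phi> \<le> N \<phi>) \<and>
     (\<exists>C0. \<forall>\<phi>\<in>E. N (markov_op K \<phi>) \<le> C0 * N \<phi>)"

text \<open>The value \<open>r 0\<close> is irrelevant: the rate is a sequence indexed by \<open>n \<ge> 1\<close>.\<close>

definition mixing_rate :: "(nat \<Rightarrow> real) \<Rightarrow> bool" where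
  "mixing_rate r \<longleftrightarrow> (\<forall>n\<ge>1. r n > 0) \<and> antimono_on {1..} r \<and> r \<longlonglongrightarrow> 0"

definition strongly_mixing ::
    "('a::polish_space \<Rightarrow> 'a measure) \<Rightarrow> 'a measure \<Rightarrow> ('a \<Rightarrow> real) set \<Rightarrow> (('a \<Rightarrow> real) \<Rightarrow> real)
     \<Rightarrow> (nat \<Rightarrow> real) \<Rightarrow> bool" where
  "strongly_mixing K \<nu> E N r \<longleftrightarrow> mixing_rate r \<and>
     (\<forall>\<phi>\<in>E. \<forall>n\<ge>1.
        sup_norm (\<lambda>x. (markov_op K ^^ n) \<phi> x - (\<integral>y. \<phi> y \<partial>\<nu>)) \<le> r n * N \<phi>)"

definition past :: "'w measure \<Rightarrow> (nat \<Rightarrow> 'w \<Rightarrow> 'a::polish_space) \<Rightarrow> nat \<Rightarrow> 'w measure" where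
  "past P Z n = sigma (space P) {Z i -` A \<inter> space P | i A. i \<le> n \<and> A \<in> sets borel}"

definition markov_chain ::
    "('a::polish_space \<Rightarrow> 'a measure) \<Rightarrow> 'w measure \<Rightarrow> (nat \<Rightarrow> 'w \<Rightarrow> 'a) \<Rightarrow> bool" where
  "markov_chain K P Z \<longleftrightarrow> prob_space P \<and> (\<forall>n. Z n \<in> measurable P borel) \<and>
     (\<forall>n. \<forall>A\<in>sets borel. AE \<omega> in P.
        real_cond_exp P (past P Z n) (\<lambda>\<omega>. indicator A (Z (Suc n) \<omega>)) \<omega> = measure (K (Z n \<omega>)) A)"

definition markov_chain_from ::
    "('a::polish_space \<Rightarrow> 'a measure) \<Rightarrow> 'a \<Rightarrow> 'w measure \<Rightarrow> (nat \<Rightarrow> 'w \<Rightarrow> 'a) \<Rightarrow> bool" where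
  "markov_chain_from K x0 P Z \<longleftrightarrow> markov_chain K P Z \<and> (AE \<omega> in P. Z 0 \<omega> = x0)"

definition birkhoff_sum :: "(nat \<Rightarrow> 'w \<Rightarrow> 'a) \<Rightarrow> ('a \<Rightarrow> real) \<Rightarrow> nat \<Rightarrow> 'w \<Rightarrow> real" where
  "birkhoff_sum Z \<phi> n \<omega> = (\<Sum>i<n. \<phi> (Z i \<omega>))"

definition deviation_set ::
    "'w measure \<Rightarrow> (nat \<Rightarrow> 'w \<Rightarrow> 'a) \<Rightarrow> 'a measure \<Rightarrow> ('a \<Rightarrow> real) \<Rightarrow> real \<Rightarrow> nat \<Rightarrow> 'w set" where
  "deviation_set P Z \<nu> \<phi> \<epsilon> n =
     {\<omega> \<in> space P. \<bar>birkhoff_sum Z \<phi> n \<omega> / real n - (\<integral>y. \<phi> y \<partial>\<nu>)\<bar> > \<epsilon>}"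

definition mixing_time :: "(nat \<Rightarrow> real) \<Rightarrow> real \<Rightarrow> real \<Rightarrow> nat" where
  "mixing_time r L \<epsilon> = (LEAST n. n \<ge> 1 \<and> r n \<le> \<epsilon> / (4 * L))"

end

theory Submission imports Defs begin

text \<open>
  The bound is a Chernoff estimate for blocks of the chain that are spaced far enough apart to be
  almost independent. Put \<open>m = \<integral> \<phi> d\<nu>\<close>, \<open>L = N \<phi>\<close> and let \<open>p\<close> be a time with
  \<open>r p \<le> \<epsilon> / (4 L)\<close>. Mixing says that \<open>p\<close> steps after any time \<open>i\<close>, whatever has happened
  up to \<open>i\<close>, the conditional mean of \<open>\<phi>(Z (i + p))\<close>, which is \<open>Q\<^sup>p \<phi> (Z i)\<close>,
  differs from \<open>m\<close> by at most \<open>\<epsilon> / 4\<close>.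

  Split the indices \<open>i < n\<close> into residue classes modulo \<open>p\<close>. Along one class, Hoeffding's lemma
  applies conditionally to each new term: it multiplies the exponential moment by at most
  \<open>exp (t \<epsilon> / 4 + t\<^sup>2 L\<^sup>2 / 2)\<close>. Only the first term of the class, over which mixing has no
  control, costs the crude factor \<open>exp (2 L t)\<close> (\<open>exp_moment_progression\<close>). Hoeffding's lemma is
  used in a form that compares \<open>exp\<close> with an affine function, so that the chain enters only
  through the identity \<open>E[G \<phi>(Z (i + p))] = E[G Q\<^sup>p \<phi> (Z i)]\<close> for variables \<open>G\<close> that
  depend on the past of \<open>i\<close> (\<open>Hoeffding_weighted\<close>, \<open>expectation_steps\<close>). The classes are far from
  independent of each other, but convexity of \<open>exp\<close> bounds the exponential of the whole sum by the
  average over the classes (\<open>exp_sum_le_mean_residue_classes\<close>).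

  The exponential Markov inequality is applied with \<open>t = \<epsilon> / (4 L\<^sup>2)\<close>. The exponent becomes
  \<open>- 5 n \<epsilon>\<^sup>2 / (32 p L\<^sup>2)\<close>, better than the claimed \<open>- 4 n \<epsilon>\<^sup>2 / (32 p L\<^sup>2)\<close>, and the
  crude factor is \<open>exp (\<epsilon> / (2 L)) \<le> exp 1 \<le> 4\<close> because deviations \<open>\<epsilon> \<ge> 2 L\<close> never occur.
  The same bound for \<open>- \<phi>\<close> handles the lower tail, and \<open>4 + 4 = 8\<close>.
\<close>

section \<open>Hoeffding's lemma with a weight\<close>

text \<open>The affine function is the chord of \<open>y \<mapsto> exp (t y)\<close> over \<open>[- L, L]\<close>: convexity puts the
  exponential below it, and the real inequality inside Hoeffding's lemma bounds it from above.
  Being affine, it can be moved through any linear identity between expectations.\<close>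

lemma exp_affine_sandwich:
  fixes L t :: real
  assumes "L > 0" and "t \<ge> 0"
  obtains a b where "\<And>y. \<bar>y\<bar> \<le> L \<Longrightarrow> exp (t * y) \<le> a + b * y"
    and "\<And>y. \<bar>y\<bar> \<le> L \<Longrightarrow> a + b * y \<le> exp (t * y + t\<^sup>2 * L\<^sup>2 / 2)"
proof
  \<comment> \<open>\<open>w y\<close> is the weight of the right end point when \<open>y\<close> is a convex combination of \<open>- L\<close> and
    \<open>L\<close>, and \<open>h\<close> is the length of the interval in units of \<open>1 / t\<close>.\<close>
  define h where "h = 2 * t * L"
  define w where "w = (\<lambda>y. (y + L) / (2 * L))"
  define b where "b = (exp (t * L) - exp (- (t * L))) / (2 * L)"
  define a where "a = (exp (t * L) + exp (- (t * L))) / 2"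
  have h: "h \<ge> 0" using assms by (simp add: h_def)
  have chord: "a + b * y = (1 - w y) * exp (t * (- L)) + w y * exp (t * L)" for y
    using assms by (simp add: a_def b_def w_def field_simps)
  have w: "0 \<le> w y" "w y \<le> 1" if "\<bar>y\<bar> \<le> L" for y
    using that assms by (auto simp: w_def field_simps)
  have y_eq: "y = (1 - w y) * (- L) + w y * L" for y
    using assms by (simp add: w_def field_simps)
  fix y :: real
  assume y: "\<bar>y\<bar> \<le> L"
  have "exp (t * ((1 - w y) *\<^sub>R (- L) + w y *\<^sub>R L)) \<le>
      (1 - w y) * exp (t * (- L)) + w y * exp (t * L)"
    using w[OF y] assms by (intro convex_onD[OF convex_on_exp]) auto
  then show "exp (t * y) \<le> a + b * y"
    using chord[of y] y_eq[of y] by simp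
  define z where "z = 1 + w y * (exp h - 1)"
  have z: "z > 0"
    unfolding z_def using w[OF y] h by (intro add_pos_nonneg mult_nonneg_nonneg) auto
  have "- h * w y + ln z \<le> h\<^sup>2 / 8"
    unfolding z_def by (rule Hoeffdings_lemma_aux[OF h w(1)[OF y]])
  then have "ln z \<le> h * w y + h\<^sup>2 / 8" by simp
  then have "z \<le> exp (h * w y + h\<^sup>2 / 8)"
    using z by (metis exp_le_cancel_iff exp_ln)
  then have "exp (- (t * L)) * z \<le> exp (- (t * L)) * exp (h * w y + h\<^sup>2 / 8)" by simp
  also have "\<dots> = exp (t * y + t\<^sup>2 * L\<^sup>2 / 2)"
    using assms by (simp add: h_def w_def power2_eq_square field_simps flip: exp_add)
  also have "exp (- (t * L)) * z = a + b * y"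
  proof -
    have "exp (- (t * L)) * exp h = exp (t * L)" by (simp add: h_def flip: exp_add)
    then have "exp (- (t * L)) * z = exp (- (t * L)) + w y * (exp (t * L) - exp (- (t * L)))"
      unfolding z_def by (simp add: algebra_simps)
    then show ?thesis using chord[of y] by (simp add: algebra_simps)
  qed
  finally show "a + b * y \<le> exp (t * y + t\<^sup>2 * L\<^sup>2 / 2)" .
qed

lemma (in finite_measure) integrable_bounded_real:
  fixes f :: "'a \<Rightarrow> real"
  assumes "f \<in> borel_measurable M" and "\<And>x. \<bar>f x\<bar> \<le> B"
  shows "integrable M f"
  using assms by (intro integrable_const_bound[where B = B]) auto

text \<open>A conditional Hoeffding lemma without conditional expectations. Read \<open>G\<close> as a variable
  known in the past and \<open>g\<close> as the conditional mean of \<open>f\<close>: only the single identity \<open>eq\<close> for the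
  given weight \<open>G\<close> enters, since the exponential of \<open>t f\<close> is replaced by an affine function of
  \<open>f\<close> before the means are exchanged.\<close>

lemma (in prob_space) Hoeffding_weighted:
  fixes G f g :: "'a \<Rightarrow> real"
  assumes [measurable]: "G \<in> borel_measurable M" "f \<in> borel_measurable M" "g \<in> borel_measurable M"
    and G: "\<And>x. 0 \<le> G x" "\<And>x. G x \<le> C"
    and f: "\<And>x. \<bar>f x\<bar> \<le> L" and g: "\<And>x. \<bar>g x\<bar> \<le> L" and q: "\<And>x. g x \<le> q"
    and eq: "expectation (\<lambda>x. G x * f x) = expectation (\<lambda>x. G x * g x)"
    and L: "L > 0" and t: "t \<ge> 0"
  shows "expectation (\<lambda>x. G x * exp (t * f x)) \<le> exp (t * q + t\<^sup>2 * L\<^sup>2 / 2) * expectation G"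
proof -
  obtain a b where upper: "\<And>y. \<bar>y\<bar> \<le> L \<Longrightarrow> exp (t * y) \<le> a + b * y"
    and lower: "\<And>y. \<bar>y\<bar> \<le> L \<Longrightarrow> a + b * y \<le> exp (t * y + t\<^sup>2 * L\<^sup>2 / 2)"
    using exp_affine_sandwich[OF L t] by blast
  have C: "0 \<le> C" using G[of undefined] by linarith
  have int_G: "integrable M G"
    using G by (intro integrable_bounded_real[of _ C]) auto
  have int_f: "integrable M (\<lambda>x. G x * f x)"
    using G f C by (intro integrable_bounded_real[of _ "C * L"]) (auto simp: abs_mult intro!: mult_mono)
  have int_g: "integrable M (\<lambda>x. G x * g x)"
    using G g C by (intro integrable_bounded_real[of _ "C * L"]) (auto simp: abs_mult intro!: mult_mono)
  have exp_le: "exp (t * f x) \<le> exp (t * L)" for x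
    using mult_left_mono[OF order_trans[OF abs_ge_self f[of x]] t] by simp
  have "\<bar>G x * exp (t * f x)\<bar> \<le> C * exp (t * L)" for x
    using mult_mono[OF G(2)[of x] exp_le[of x] C] G(1)[of x] by (simp add: abs_mult)
  then have int_exp: "integrable M (\<lambda>x. G x * exp (t * f x))"
    by (intro integrable_bounded_real) auto
  have "expectation (\<lambda>x. G x * exp (t * f x)) \<le> expectation (\<lambda>x. a * G x + b * (G x * f x))"
  proof (rule integral_mono[OF int_exp])
    fix x
    show "G x * exp (t * f x) \<le> a * G x + b * (G x * f x)"
      using mult_left_mono[OF upper[OF f[of x]] G(1)[of x]] by (simp add: algebra_simps)
  qed (use int_G int_f in auto)
  also have "\<dots> = expectation (\<lambda>x. a * G x + b * (G x * g x))"
    using int_G int_f int_g eq by simp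
  also have "\<dots> \<le> expectation (\<lambda>x. exp (t * q + t\<^sup>2 * L\<^sup>2 / 2) * G x)"
  proof (rule integral_mono)
    fix x
    have "a + b * g x \<le> exp (t * g x + t\<^sup>2 * L\<^sup>2 / 2)" by (rule lower[OF g])
    also have "\<dots> \<le> exp (t * q + t\<^sup>2 * L\<^sup>2 / 2)"
      using mult_left_mono[OF q[of x] t] by simp
    finally show "a * G x + b * (G x * g x) \<le> exp (t * q + t\<^sup>2 * L\<^sup>2 / 2) * G x"
      using mult_left_mono[OF _ G(1)[of x]] by (fastforce simp: algebra_simps)
  qed (use int_G int_g in auto)
  finally show ?thesis by simp
qed

section \<open>Bounded observables and kernels\<close>

lemma Linf_bounded:
  assumes "f \<in> Linf"
  obtains B where "\<And>x. \<bar>f x\<bar> \<le> B"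
  using assms unfolding Linf_def bounded_real by auto

lemma Linf_measurable: "f \<in> Linf \<Longrightarrow> f \<in> borel_measurable borel"
  by (simp add: Linf_def)

text \<open>Rounding \<open>f\<close> down to a multiple of \<open>e\<close>. The error is uniform, so integrals and
  conditional expectations of \<open>f\<close> and of its approximation differ by at most \<open>e\<close> as well.\<close>

lemma Linf_uniform_simple_approximation:
  fixes f :: "'a::polish_space \<Rightarrow> real"
  assumes f: "f \<in> Linf" and e: "e > 0"
  obtains I :: "int set" and c :: "int \<Rightarrow> real" and A :: "int \<Rightarrow> 'a set"
  where "finite I" and "\<And>i. A i \<in> sets borel"
    and "\<And>x. \<bar>f x - (\<Sum>i\<in>I. c i * indicator (A i) x)\<bar> \<le> e"
proof -
  note Linf_measurable[OF f, measurable]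
  obtain B where B: "\<And>x. \<bar>f x\<bar> \<le> B" using Linf_bounded[OF f] by blast
  define I where "I = {\<lfloor>- B / e\<rfloor>..\<lfloor>B / e\<rfloor>}"
  define A where "A = (\<lambda>i. {x. \<lfloor>f x / e\<rfloor> = i})"
  show thesis
  proof
    show "finite I" by (simp add: I_def)
    show "A i \<in> sets borel" for i unfolding A_def by measurable
    fix x
    have "- B / e \<le> f x / e" "f x / e \<le> B / e"
      using B[of x] e by (intro divide_right_mono; simp add: abs_le_iff)+
    then have "\<lfloor>f x / e\<rfloor> \<in> I" by (auto simp: I_def intro: floor_mono)
    then have "(\<Sum>i\<in>I. e * of_int i * indicator (A i) x) = e * of_int \<lfloor>f x / e\<rfloor>"
      by (simp add: A_def indicator_def I_def if_distrib cong: if_cong)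
    moreover have "\<bar>f x / e - of_int \<lfloor>f x / e\<rfloor>\<bar> \<le> 1" by linarith
    then have "\<bar>f x - e * of_int \<lfloor>f x / e\<rfloor>\<bar> \<le> e"
      using e by (simp add: field_simps abs_le_iff)
    ultimately show "\<bar>f x - (\<Sum>i\<in>I. e * of_int i * indicator (A i) x)\<bar> \<le> e" by simp
  qed
qed

text \<open>The weak topology lives on the set of Borel probability measures, so a continuous map into it
  takes values there.\<close>

lemma markov_kernel_prob:
  assumes "markov_kernel K"
  shows "K x \<in> space (prob_algebra borel)"
proof -
  have "K x \<in> topspace weak_prob_topology"
    using assms continuous_map_image_subset_topspace unfolding markov_kernel_def by fastforce
  then show ?thesis by (auto simp: weak_prob_topology_def)
qed

lemma abs_integral_diff_le:
  assumes "\<mu> \<in> space (prob_algebra borel)" and "f \<in> Linf" and "g \<in> Linf"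
    and "\<And>x. \<bar>f x - g x\<bar> \<le> e"
  shows "\<bar>(\<integral>x. f x \<partial>\<mu>) - (\<integral>x. g x \<partial>\<mu>)\<bar> \<le> e"
proof -
  interpret prob_space \<mu> using assms(1) by (simp add: space_prob_algebra)
  have [measurable_cong]: "sets \<mu> = sets borel" using assms(1) by (simp add: space_prob_algebra)
  have int: "integrable \<mu> h" if h: "h \<in> Linf" for h
  proof -
    note Linf_measurable[OF h, measurable]
    obtain B where "\<bar>h x\<bar> \<le> B" for x using Linf_bounded[OF h] by blast
    then show ?thesis by (intro integrable_bounded_real[of _ B]) auto
  qed
  note [simp] = int[OF assms(2)] int[OF assms(3)]
  have "\<bar>(\<integral>x. f x \<partial>\<mu>) - (\<integral>x. g x \<partial>\<mu>)\<bar> = \<bar>\<integral>x. f x - g x \<partial>\<mu>\<bar>" by simp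
  also have "\<dots> \<le> (\<integral>x. \<bar>f x - g x\<bar> \<partial>\<mu>)" by (rule integral_abs_bound)
  also have "\<dots> \<le> e" using assms(4) by (intro integral_le_const) auto
  finally show ?thesis .
qed

lemma abs_integral_le:
  assumes "\<mu> \<in> space (prob_algebra borel)" and "f \<in> Linf" and "\<And>x. \<bar>f x\<bar> \<le> B"
  shows "\<bar>\<integral>x. f x \<partial>\<mu>\<bar> \<le> B"
  using abs_integral_diff_le[OF assms(1,2), of "\<lambda>_. 0" B] assms(3) by (simp add: Linf_def)

section \<open>Conditional expectations along the chain\<close>

text \<open>Fixing one law of the chain makes \<open>prob\<close> and \<open>expectation\<close> refer to it throughout; a weakly
  continuous kernel satisfies \<open>K_prob\<close> by \<open>markov_kernel_prob\<close>.\<close>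

locale kernel_chain = prob_space P
  for P :: "'w measure" +
  fixes K :: "'a::polish_space \<Rightarrow> 'a measure" and Z :: "nat \<Rightarrow> 'w \<Rightarrow> 'a"
  assumes K_prob: "\<And>x. K x \<in> space (prob_algebra borel)"
    and Z_measurable [measurable]: "\<And>n. Z n \<in> measurable P borel"
    and cond_exp_indicator: "\<And>n A. A \<in> sets borel \<Longrightarrow> AE \<omega> in P.
      real_cond_exp P (past P Z n) (\<lambda>\<omega>. indicator A (Z (Suc n) \<omega>)) \<omega> = measure (K (Z n \<omega>)) A"
begin

lemma subalgebra_past: "subalgebra P (past P Z n)"
proof -
  have "sigma_sets (space P) {Z i -` A \<inter> space P | i A. i \<le> n \<and> A \<in> sets borel} \<subseteq> sets P"
    by (intro sets.sigma_sets_subset) (auto intro: measurable_sets[OF Z_measurable])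
  moreover have "{Z i -` A \<inter> space P | i A. i \<le> n \<and> A \<in> sets borel} \<subseteq> Pow (space P)"
    by blast
  ultimately show ?thesis
    unfolding subalgebra_def past_def by (simp add: space_measure_of_conv)
qed

lemma Z_measurable_past:
  assumes "i \<le> n"
  shows "Z i \<in> measurable (past P Z n) borel"
proof (rule measurableI)
  fix A :: "'a set"
  assume "A \<in> sets borel"
  then have "Z i -` A \<inter> space P \<in> {Z i -` A \<inter> space P | i A. i \<le> n \<and> A \<in> sets borel}"
    using assms by blast
  then show "Z i -` A \<inter> space (past P Z n) \<in> sets (past P Z n)"
    unfolding past_def space_measure_of_conv
    by (subst sets_measure_of) (blast intro: sigma_sets.Basic)+
qed simp

lemma past_mono:
  assumes "f \<in> borel_measurable (past P Z i)" and "i \<le> n"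
  shows "f \<in> borel_measurable (past P Z n)"
proof -
  have "subalgebra (past P Z n) (past P Z i)"
    unfolding subalgebra_def past_def
  proof
    have "sigma_sets (space P) {Z j -` A \<inter> space P | j A. j \<le> i \<and> A \<in> sets borel} \<subseteq>
        sigma_sets (space P) {Z j -` A \<inter> space P | j A. j \<le> n \<and> A \<in> sets borel}"
      using assms(2) by (intro sigma_sets_mono') force
    then show "sets (sigma (space P) {Z j -` A \<inter> space P | j A. j \<le> i \<and> A \<in> sets borel}) \<subseteq>
        sets (sigma (space P) {Z j -` A \<inter> space P | j A. j \<le> n \<and> A \<in> sets borel})"
      by (subst (1 2) sets_measure_of) blast+
  qed (simp add: space_measure_of_conv)
  then show ?thesis using assms(1) measurable_from_subalg by blast
qed

text \<open>The Markov property is given for indicators. It extends to simple functions by linearity,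
  and then to bounded \<open>\<psi>\<close> by uniform approximation: an error of at most \<open>e\<close> in \<open>\<psi>\<close>
  changes the left side by at most \<open>e\<close> almost surely and the right side by at most \<open>e\<close>
  everywhere, so letting \<open>e\<close> run through \<open>1 / (k + 1)\<close> leaves a single null set.\<close>

lemma cond_exp_markov_op:
  assumes \<psi>: "\<psi> \<in> Linf"
  shows "AE \<omega> in P. real_cond_exp P (past P Z n) (\<lambda>\<omega>. \<psi> (Z (Suc n) \<omega>)) \<omega> = markov_op K \<psi> (Z n \<omega>)"
proof -
  interpret finite_measure_subalgebra P "past P Z n"
    by unfold_locales (rule subalgebra_past)
  note Linf_measurable[OF \<psi>, measurable]
  obtain B where B: "\<And>x. \<bar>\<psi> x\<bar> \<le> B" using Linf_bounded[OF \<psi>] by blast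
  let ?ce = "real_cond_exp P (past P Z n)"
  let ?\<psi> = "\<lambda>\<omega>. \<psi> (Z (Suc n) \<omega>)"
  have int_\<psi>: "integrable P ?\<psi>"
    using B by (intro integrable_bounded_real[of _ B]) auto
  have close: "AE \<omega> in P. \<bar>?ce ?\<psi> \<omega> - markov_op K \<psi> (Z n \<omega>)\<bar> \<le> 2 * e" if e: "e > 0" for e
  proof -
    obtain I :: "int set" and c A where I: "finite I" and A: "\<And>i. A i \<in> sets borel"
      and approx: "\<And>x. \<bar>\<psi> x - (\<Sum>i\<in>I. c i * indicator (A i) x)\<bar> \<le> e"
      using Linf_uniform_simple_approximation[OF \<psi> e] by metis
    note A [measurable]
    define s where "s = (\<lambda>x. \<Sum>i\<in>I. c i * indicator (A i) x :: real)"
    have [measurable]: "s \<in> borel_measurable borel" unfolding s_def by measurable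
    have approx: "\<bar>\<psi> x - s x\<bar> \<le> e" for x using approx by (simp add: s_def)
    have approx_upper: "\<psi> x - s x \<le> e" and approx_lower: "- e \<le> \<psi> x - s x" for x
      using approx[of x] by (auto simp: abs_le_iff)
    have s_le: "\<bar>s x\<bar> \<le> B + e" for x using approx[of x] B[of x] by linarith
    have s: "s \<in> Linf" using s_le by (auto simp: Linf_def bounded_real)
    let ?s = "\<lambda>\<omega>. s (Z (Suc n) \<omega>)"
    have int_s: "integrable P ?s"
      using s_le by (intro integrable_bounded_real[of _ "B + e"]) auto
    have int_ind: "integrable P (\<lambda>\<omega>. indicator (A i) (Z (Suc n) \<omega>) :: real)" for i
      by (intro integrable_bounded_real[of _ 1]) (auto simp: indicator_def)
    have markov_op_s: "markov_op K s x = (\<Sum>i\<in>I. c i * measure (K x) (A i))" for x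
    proof -
      interpret Kx: prob_space "K x" using K_prob[of x] by (simp add: space_prob_algebra)
      have [measurable_cong]: "sets (K x) = sets borel"
        using K_prob[of x] by (simp add: space_prob_algebra)
      have "space (K x) = UNIV" using sets_eq_imp_space_eq[OF \<open>sets (K x) = sets borel\<close>] by simp
      moreover have "integrable (K x) (indicator (A i) :: 'a \<Rightarrow> real)" for i
        by (intro Kx.integrable_bounded_real[of _ 1]) (auto simp: indicator_def)
      ultimately show ?thesis
        unfolding markov_op_def s_def by (simp add: Bochner_Integration.integral_sum)
    qed
    have "AE \<omega> in P. ?ce ?s \<omega> = (\<Sum>i\<in>I. ?ce (\<lambda>\<omega>. c i * indicator (A i) (Z (Suc n) \<omega>)) \<omega>)"
      unfolding s_def using int_ind by (intro real_cond_exp_sum) auto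
    moreover have "AE \<omega> in P. \<forall>i\<in>I. ?ce (\<lambda>\<omega>. c i * indicator (A i) (Z (Suc n) \<omega>)) \<omega> =
        c i * ?ce (\<lambda>\<omega>. indicator (A i) (Z (Suc n) \<omega>)) \<omega>"
      using int_ind I by (intro AE_finite_allI real_cond_exp_cmult)
    moreover have "AE \<omega> in P. \<forall>i\<in>I. ?ce (\<lambda>\<omega>. indicator (A i) (Z (Suc n) \<omega>)) \<omega> = measure (K (Z n \<omega>)) (A i)"
      using I A by (intro AE_finite_allI cond_exp_indicator)
    ultimately have "AE \<omega> in P. ?ce ?s \<omega> = markov_op K s (Z n \<omega>)"
      by eventually_elim (simp add: markov_op_s)
    moreover have "AE \<omega> in P. ?ce (\<lambda>\<omega>. ?\<psi> \<omega> - ?s \<omega>) \<omega> = ?ce ?\<psi> \<omega> - ?ce ?s \<omega>"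
      using int_\<psi> int_s by (rule real_cond_exp_diff)
    moreover have "AE \<omega> in P. ?ce (\<lambda>\<omega>. ?\<psi> \<omega> - ?s \<omega>) \<omega> \<le> e"
      using int_\<psi> int_s approx_upper by (intro real_cond_exp_le_c) auto
    moreover have "AE \<omega> in P. ?ce (\<lambda>\<omega>. ?\<psi> \<omega> - ?s \<omega>) \<omega> \<ge> - e"
      using int_\<psi> int_s approx_lower by (intro real_cond_exp_ge_c) auto
    ultimately show ?thesis
    proof eventually_elim
      case (elim \<omega>)
      moreover have "\<bar>markov_op K \<psi> (Z n \<omega>) - markov_op K s (Z n \<omega>)\<bar> \<le> e"
        unfolding markov_op_def using K_prob \<psi> s approx by (rule abs_integral_diff_le)
      ultimately show ?case by linarith
    qed
  qed
  have "AE \<omega> in P. \<forall>k::nat. \<bar>?ce ?\<psi> \<omega> - markov_op K \<psi> (Z n \<omega>)\<bar> \<le> 2 * (1 / real (Suc k))"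
    unfolding AE_all_countable by (intro allI close) simp
  then show ?thesis
  proof eventually_elim
    case (elim \<omega>)
    have "(\<lambda>k. 2 * (1 / real (Suc k))) \<longlonglongrightarrow> 2 * 0"
      by (intro tendsto_mult tendsto_const LIMSEQ_inverse_real_of_nat[unfolded inverse_eq_divide])
    then have "\<bar>?ce ?\<psi> \<omega> - markov_op K \<psi> (Z n \<omega>)\<bar> \<le> 2 * 0"
      using elim by (intro LIMSEQ_le_const) blast+
    then show ?case by simp
  qed
qed


lemma expectation_one_step:
  assumes G: "G \<in> borel_measurable (past P Z n)" and bound: "\<And>\<omega>. \<bar>G \<omega>\<bar> \<le> C"
    and \<psi>: "\<psi> \<in> Linf" "markov_op K \<psi> \<in> Linf"
  shows "expectation (\<lambda>\<omega>. G \<omega> * \<psi> (Z (Suc n) \<omega>)) = expectation (\<lambda>\<omega>. G \<omega> * markov_op K \<psi> (Z n \<omega>))"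
proof -
  interpret finite_measure_subalgebra P "past P Z n"
    by unfold_locales (rule subalgebra_past)
  note \<psi>[THEN Linf_measurable, measurable] G[measurable]
  have G_P [measurable]: "G \<in> borel_measurable P"
    using G subalgebra_past measurable_from_subalg by blast
  obtain B where B: "\<And>x. \<bar>\<psi> x\<bar> \<le> B" using Linf_bounded[OF \<psi>(1)] by blast
  have "\<bar>G \<omega> * \<psi> (Z (Suc n) \<omega>)\<bar> \<le> C * B" for \<omega>
    unfolding abs_mult by (rule mult_mono'[OF bound B]) auto
  then have "integrable P (\<lambda>\<omega>. G \<omega> * \<psi> (Z (Suc n) \<omega>))"
    by (intro integrable_bounded_real) auto
  then have "expectation (\<lambda>\<omega>. G \<omega> * \<psi> (Z (Suc n) \<omega>)) =
      expectation (\<lambda>\<omega>. G \<omega> * real_cond_exp P (past P Z n) (\<lambda>\<omega>. \<psi> (Z (Suc n) \<omega>)) \<omega>)"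
    using G by (intro real_cond_exp_intg(2)[symmetric]) auto
  also have "\<dots> = expectation (\<lambda>\<omega>. G \<omega> * markov_op K \<psi> (Z n \<omega>))"
    using cond_exp_markov_op[OF \<psi>(1), of n] by (intro integral_cong_AE) auto
  finally show ?thesis .
qed

text \<open>A variable from the past of \<open>n\<close> also belongs to the past of \<open>n + k\<close>, so the one-step
  identity can be applied \<open>k\<close> times, each time trading one step of the chain for one application
  of the Markov operator. The set \<open>F\<close> stands for an invariant class of observables, such as an
  admissible space; invariance keeps all iterates measurable.\<close>

lemma expectation_steps:
  assumes F: "F \<subseteq> Linf" "\<And>f. f \<in> F \<Longrightarrow> markov_op K f \<in> F"
    and G: "G \<in> borel_measurable (past P Z n)" "\<And>\<omega>. \<bar>G \<omega>\<bar> \<le> C"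
    and "\<psi> \<in> F"
  shows "expectation (\<lambda>\<omega>. G \<omega> * \<psi> (Z (n + k) \<omega>)) = expectation (\<lambda>\<omega>. G \<omega> * (markov_op K ^^ k) \<psi> (Z n \<omega>))"
  using \<open>\<psi> \<in> F\<close>
proof (induction k arbitrary: \<psi>)
  case (Suc k)
  have "G \<in> borel_measurable (past P Z (n + k))"
    using G(1) by (rule past_mono) simp
  then have "expectation (\<lambda>\<omega>. G \<omega> * \<psi> (Z (Suc (n + k)) \<omega>)) =
      expectation (\<lambda>\<omega>. G \<omega> * markov_op K \<psi> (Z (n + k) \<omega>))"
    using F Suc.prems by (intro expectation_one_step[OF _ G(2)]) auto
  also have "\<dots> = expectation (\<lambda>\<omega>. G \<omega> * (markov_op K ^^ k) (markov_op K \<psi>) (Z n \<omega>))"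
    using F(2)[OF Suc.prems] by (rule Suc.IH)
  finally show ?case by (simp add: funpow_swap1)
qed simp

lemma markov_op_funpow_bounded:
  assumes F: "F \<subseteq> Linf" "\<And>f. f \<in> F \<Longrightarrow> markov_op K f \<in> F"
    and \<phi>: "\<phi> \<in> F" "\<And>x. \<bar>\<phi> x\<bar> \<le> L"
  shows "(markov_op K ^^ k) \<phi> \<in> F \<and> (\<forall>x. \<bar>(markov_op K ^^ k) \<phi> x\<bar> \<le> L)"
proof (induction k)
  case (Suc k)
  then have "\<bar>markov_op K ((markov_op K ^^ k) \<phi>) x\<bar> \<le> L" for x
    unfolding markov_op_def[of K "(markov_op K ^^ k) \<phi>"]
    using F(1) by (intro abs_integral_le[OF K_prob]) auto
  with Suc F(2) show ?case by simp
qed (use \<phi> in auto)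

section \<open>Exponential moments\<close>

text \<open>Induction on the number of terms. The last term lies \<open>p\<close> steps after the one before it, so
  given the past of that one its conditional mean is at most \<open>m + d\<close>, and the weighted Hoeffding
  lemma applies with the exponential of the earlier terms as the weight. The first term has no
  predecessor and is bounded by \<open>2 L\<close>.\<close>

lemma exp_moment_progression:
  assumes F: "F \<subseteq> Linf" "\<And>f. f \<in> F \<Longrightarrow> markov_op K f \<in> F"
    and \<phi>: "\<phi> \<in> F" "\<And>x. \<bar>\<phi> x\<bar> \<le> L" and L: "L > 0" and m: "\<bar>m\<bar> \<le> L"
    and mix: "\<And>x. (markov_op K ^^ p) \<phi> x \<le> m + d" and t: "t \<ge> 0"
  shows "expectation (\<lambda>\<omega>. exp (t * (\<Sum>k\<le>q. \<phi> (Z (j + k * p) \<omega>) - m)))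
    \<le> exp (2 * L * t + real q * (t * d + t\<^sup>2 * L\<^sup>2 / 2))"
proof (induction q)
  have \<phi>_borel [measurable]: "\<phi> \<in> borel_measurable borel"
    using \<phi>(1) F(1) Linf_measurable by blast
  have centred: "t * (\<phi> x - m) \<le> 2 * L * t" for x
    using mult_left_mono[of "\<phi> x - m" "2 * L" t] \<phi>(2)[of x] m t by (simp add: abs_le_iff mult.commute)
  {
    case 0
    have "integrable P (\<lambda>\<omega>. exp (t * (\<phi> (Z j \<omega>) - m)))"
      using centred by (intro integrable_bounded_real[of _ "exp (2 * L * t)"]) auto
    then have "expectation (\<lambda>\<omega>. exp (t * (\<phi> (Z j \<omega>) - m))) \<le> exp (2 * L * t)"
      using centred by (intro integral_le_const) auto
    then show ?case by simp
  next
    case (Suc q)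
    define i where "i = j + q * p"
    define G where "G = (\<lambda>\<omega>. exp (t * (\<Sum>k\<le>q. \<phi> (Z (j + k * p) \<omega>) - m)))"
    define v where "v = t * d + t\<^sup>2 * L\<^sup>2 / 2"
    have G_past: "G \<in> borel_measurable (past P Z i)"
    proof -
      have "(\<lambda>\<omega>. \<phi> (Z (j + k * p) \<omega>)) \<in> borel_measurable (past P Z i)" if "k \<le> q" for k
        using that by (intro measurable_compose[OF Z_measurable_past \<phi>_borel]) (simp add: i_def)
      then show ?thesis
        unfolding G_def by (auto intro!: borel_measurable_sum borel_measurable_times
          borel_measurable_diff measurable_compose[OF _ borel_measurable_exp])
    qed
    have [measurable]: "G \<in> borel_measurable P"
      using G_past subalgebra_past measurable_from_subalg by blast
    have G_le: "G \<omega> \<le> exp (real (Suc q) * (2 * L * t))" for \<omega>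
    proof -
      have "t * (\<Sum>k\<le>q. \<phi> (Z (j + k * p) \<omega>) - m) \<le> (\<Sum>k\<le>q. 2 * L * t)"
        unfolding sum_distrib_left by (intro sum_mono centred)
      then show ?thesis by (simp add: G_def)
    qed
    have Qp: "(markov_op K ^^ p) \<phi> \<in> F" "\<bar>(markov_op K ^^ p) \<phi> x\<bar> \<le> L" for x
      using markov_op_funpow_bounded[OF F \<phi>] by auto
    then have [measurable]: "(markov_op K ^^ p) \<phi> \<in> borel_measurable borel"
      using F(1) Linf_measurable by blast
    have "expectation (\<lambda>\<omega>. G \<omega> * exp (t * \<phi> (Z (i + p) \<omega>)))
        \<le> exp (t * (m + d) + t\<^sup>2 * L\<^sup>2 / 2) * expectation G"
    proof (rule Hoeffding_weighted[OF _ _ _ _ G_le _ _ mix _ L t])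
      show "expectation (\<lambda>\<omega>. G \<omega> * \<phi> (Z (i + p) \<omega>)) = expectation (\<lambda>\<omega>. G \<omega> * (markov_op K ^^ p) \<phi> (Z i \<omega>))"
        by (rule expectation_steps[OF F G_past _ \<phi>(1), where C = "exp (real (Suc q) * (2 * L * t))"])
          (use G_le in \<open>auto simp: G_def\<close>)
    qed (use \<phi>(2) Qp(2) in \<open>auto simp: G_def\<close>)
    then have "exp (- (t * m)) * expectation (\<lambda>\<omega>. G \<omega> * exp (t * \<phi> (Z (i + p) \<omega>)))
        \<le> exp (- (t * m)) * (exp (t * (m + d) + t\<^sup>2 * L\<^sup>2 / 2) * expectation G)"
      by simp
    also have "\<dots> = exp v * expectation G"
      by (simp add: v_def algebra_simps flip: exp_add mult.assoc)
    also have "\<dots> \<le> exp v * exp (2 * L * t + real q * v)"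
      using Suc by (simp add: G_def v_def)
    also have "\<dots> = exp (2 * L * t + real (Suc q) * v)"
      by (simp add: algebra_simps flip: exp_add)
    also have "exp (- (t * m)) * expectation (\<lambda>\<omega>. G \<omega> * exp (t * \<phi> (Z (i + p) \<omega>))) =
        expectation (\<lambda>\<omega>. exp (t * (\<Sum>k\<le>Suc q. \<phi> (Z (j + k * p) \<omega>) - m)))"
      unfolding Bochner_Integration.integral_mult_right_zero[symmetric]
      by (intro Bochner_Integration.integral_cong)
        (simp_all add: G_def i_def algebra_simps flip: exp_add)
    finally show ?case by (simp add: v_def)
  }
qed

end

text \<open>The class of \<open>j\<close> consists of the \<open>j + k p < n\<close>, that is \<open>k \<le> (n - 1 - j) div p\<close>. The
  hypothesis \<open>p \<le> n\<close> makes every class nonempty, so that the truncated subtraction is harmless.\<close>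

lemma sum_residue_classes:
  fixes f :: "nat \<Rightarrow> real"
  assumes "p \<ge> 1" and "p \<le> n"
  shows "(\<Sum>i<n. f i) = (\<Sum>j<p. \<Sum>k\<le>(n - 1 - j) div p. f (j + k * p))"
proof -
  have mem: "j + k * p < n \<longleftrightarrow> k \<le> (n - 1 - j) div p" if "j < p" for j k
    using that assms by (simp add: less_eq_div_iff_mult_less_eq) linarith
  have "(\<Sum>j<p. \<Sum>k\<le>(n - 1 - j) div p. f (j + k * p)) =
      (\<Sum>(j, k)\<in>Sigma {..<p} (\<lambda>j. {..(n - 1 - j) div p}). f (j + k * p))"
    by (subst sum.Sigma) auto
  also have "\<dots> = (\<Sum>i<n. f i)"
  proof (rule sum.reindex_bij_witness[where i = "\<lambda>i. (i mod p, i div p)" and j = "\<lambda>(j, k). j + k * p"], goal_cases)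
    case (1 a)
    then show ?case by (cases a) auto
  next
    case (2 a)
    then show ?case by (cases a) (auto simp: mem)
  next
    case (4 i)
    have "i mod p < p" using assms by simp
    moreover have "i mod p + i div p * p < n" using 4 by simp
    ultimately have "i div p \<le> (n - 1 - i mod p) div p" by (rule iffD1[OF mem])
    then show ?case using \<open>i mod p < p\<close> by simp
  qed auto
  finally show ?thesis by simp
qed

text \<open>Jensen's inequality for \<open>exp\<close>: the total is the mean over the \<open>p\<close> classes of \<open>p\<close> times
  the class sum.\<close>

lemma exp_sum_le_mean_residue_classes:
  fixes X :: "nat \<Rightarrow> real"
  assumes "p \<ge> 1" and "p \<le> n" and "s \<ge> 0"
  shows "exp (s * (\<Sum>i<n. X i)) \<le>
    (\<Sum>j<p. (1 / real p) * exp (real p * s * (\<Sum>k\<le>(n - 1 - j) div p. X (j + k * p))))"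
proof -
  let ?Y = "\<lambda>j. real p * (\<Sum>k\<le>(n - 1 - j) div p. X (j + k * p))"
  have "exp (s * (\<Sum>j<p. (1 / real p) *\<^sub>R ?Y j)) \<le> (\<Sum>j<p. (1 / real p) * exp (s * ?Y j))"
    by (rule convex_on_sum[OF _ _ convex_on_exp]) (use assms in \<open>auto simp: lessThan_empty_iff\<close>)
  moreover have "(\<Sum>j<p. (1 / real p) *\<^sub>R ?Y j) = (\<Sum>i<n. X i)"
    using assms by (simp add: sum_residue_classes[of p n X])
  ultimately show ?thesis by (simp add: mult_ac)
qed

section \<open>Tail bounds\<close>

context kernel_chain
begin

lemma upper_tail:
  assumes F: "F \<subseteq> Linf" "\<And>f. f \<in> F \<Longrightarrow> markov_op K f \<in> F"
    and \<phi>: "\<phi> \<in> F" "\<And>x. \<bar>\<phi> x\<bar> \<le> L" and L: "L > 0" and m: "\<bar>m\<bar> \<le> L"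
    and \<epsilon>: "\<epsilon> > 0" and mix: "\<And>x. (markov_op K ^^ p) \<phi> x \<le> m + \<epsilon> / 4"
    and p: "1 \<le> p" "p \<le> n"
  shows "prob {\<omega> \<in> space P. birkhoff_sum Z \<phi> n \<omega> / real n - m > \<epsilon>}
    \<le> 4 * exp (- (1 / (8 * L\<^sup>2) * (\<epsilon>\<^sup>2 / real p)) * real n)"
proof (cases "\<epsilon> < 2 * L")
  case False
  \<comment> \<open>Both the average and \<open>m\<close> lie in \<open>[- L, L]\<close>, so the event is empty.\<close>
  have "birkhoff_sum Z \<phi> n \<omega> / real n - m \<le> \<epsilon>" for \<omega>
  proof -
    have "birkhoff_sum Z \<phi> n \<omega> \<le> (\<Sum>i<n. L)"
      unfolding birkhoff_sum_def using \<phi>(2) by (intro sum_mono) (simp add: abs_le_iff)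
    then have "birkhoff_sum Z \<phi> n \<omega> / real n \<le> L" using p by (simp add: field_simps)
    then show ?thesis using False m by linarith
  qed
  then show ?thesis by (simp add: not_less[symmetric])
next
  case True
  have [measurable]: "\<phi> \<in> borel_measurable borel" using \<phi>(1) F(1) Linf_measurable by blast
  \<comment> \<open>A smaller \<open>t\<close> than the optimal \<open>3 \<epsilon> / (4 L\<^sup>2)\<close>: it still gives the required rate and
    keeps the cost \<open>exp (2 L t)\<close> of the first terms below \<open>4\<close>.\<close>
  define t where "t = \<epsilon> / (4 * L\<^sup>2)"
  define s where "s = t / real p"
  define v where "v = t * (\<epsilon> / 4) + t\<^sup>2 * L\<^sup>2 / 2"
  define X where "X = (\<lambda>i \<omega>. \<phi> (Z i \<omega>) - m)"
  define Y where "Y = (\<lambda>j \<omega>. exp (t * (\<Sum>k\<le>(n - 1 - j) div p. X (j + k * p) \<omega>)))"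
  define u where "u = 2 * L * t + real n / real p * v"
  have t: "t > 0" and s: "s > 0" using \<epsilon> L p by (simp_all add: t_def s_def)
  have v: "v = 3 * \<epsilon>\<^sup>2 / (32 * L\<^sup>2)"
    using L by (simp add: v_def t_def field_simps power2_eq_square)
  have [measurable]: "X i \<in> borel_measurable P" for i unfolding X_def by measurable
  have [measurable]: "Y j \<in> borel_measurable P" for j unfolding Y_def by measurable
  have X_le: "\<bar>X i \<omega>\<bar> \<le> 2 * L" for i \<omega>
    using \<phi>(2)[of "Z i \<omega>"] m unfolding X_def by linarith
  have int_exp: "integrable P (\<lambda>\<omega>. exp (a * (\<Sum>i\<in>I. X (h i) \<omega>)))"
    if "a \<ge> 0" for a :: real and I and h :: "nat \<Rightarrow> nat"
  proof (rule integrable_bounded_real)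
    fix \<omega>
    have "(\<Sum>i\<in>I. X (h i) \<omega>) \<le> (\<Sum>i\<in>I. 2 * L)"
      using X_le by (intro sum_mono) (simp add: abs_le_iff)
    then show "\<bar>exp (a * (\<Sum>i\<in>I. X (h i) \<omega>))\<bar> \<le> exp (a * (\<Sum>i\<in>I. 2 * L))"
      using that by (simp add: mult_left_mono)
  qed measurable
  have int_Y: "integrable P (Y j)" for j unfolding Y_def using t by (intro int_exp) simp
  have moment: "expectation (Y j) \<le> exp u" if "j < p" for j
  proof -
    have "expectation (Y j) \<le> exp (2 * L * t + real ((n - 1 - j) div p) * v)"
      unfolding Y_def X_def v_def by (rule exp_moment_progression[OF F \<phi> L m mix less_imp_le[OF t]])
    also have "\<dots> \<le> exp u"
    proof -
      have "real ((n - 1 - j) div p) \<le> real (n - 1 - j) / real p"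
        by (rule of_nat_div_le_of_nat)
      also have "\<dots> \<le> real n / real p" by (simp add: divide_right_mono)
      finally show ?thesis
        unfolding u_def exp_le_cancel_iff by (intro add_left_mono mult_right_mono) (simp_all add: v)
    qed
    finally show ?thesis .
  qed
  have "expectation (\<lambda>\<omega>. exp (s * (\<Sum>i<n. X i \<omega>))) \<le> expectation (\<lambda>\<omega>. \<Sum>j<p. (1 / real p) * Y j \<omega>)"
  proof (rule integral_mono)
    show "integrable P (\<lambda>\<omega>. exp (s * (\<Sum>i<n. X i \<omega>)))"
      using int_exp[of s "\<lambda>i. i"] s by simp
    show "exp (s * (\<Sum>i<n. X i \<omega>)) \<le> (\<Sum>j<p. (1 / real p) * Y j \<omega>)" for \<omega>
      using exp_sum_le_mean_residue_classes[OF p, of s "\<lambda>i. X i \<omega>"] s p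
      by (simp add: Y_def s_def)
  qed (use int_Y in auto)
  also have "\<dots> = (\<Sum>j<p. (1 / real p) * expectation (Y j))"
    using int_Y by simp
  also have "\<dots> \<le> (\<Sum>j<p. (1 / real p) * exp u)"
    using moment by (intro sum_mono mult_left_mono) auto
  also have "\<dots> = exp u" using p by simp
  finally have moment_sum: "expectation (\<lambda>\<omega>. exp (s * (\<Sum>i<n. X i \<omega>))) \<le> exp u" .
  have "prob {\<omega> \<in> space P. birkhoff_sum Z \<phi> n \<omega> / real n - m > \<epsilon>} \<le>
      prob {\<omega> \<in> space P. exp (s * (\<Sum>i<n. X i \<omega>)) \<ge> exp (s * (real n * \<epsilon>))}"
  proof (rule finite_measure_mono)
    have "s * (real n * \<epsilon>) \<le> s * (\<Sum>i<n. X i \<omega>)" if "birkhoff_sum Z \<phi> n \<omega> / real n - m > \<epsilon>" for \<omega>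
    proof -
      have "(\<Sum>i<n. X i \<omega>) = birkhoff_sum Z \<phi> n \<omega> - real n * m"
        by (simp add: X_def birkhoff_sum_def sum_subtractf)
      moreover have "birkhoff_sum Z \<phi> n \<omega> > real n * (\<epsilon> + m)"
        using that p by (simp add: field_simps)
      ultimately show ?thesis using s by (intro mult_left_mono) (simp_all add: algebra_simps)
    qed
    then show "{\<omega> \<in> space P. birkhoff_sum Z \<phi> n \<omega> / real n - m > \<epsilon>} \<subseteq>
        {\<omega> \<in> space P. exp (s * (\<Sum>i<n. X i \<omega>)) \<ge> exp (s * (real n * \<epsilon>))}"
      by auto
  qed measurable
  also have "\<dots> \<le> expectation (\<lambda>\<omega>. exp (s * (\<Sum>i<n. X i \<omega>))) / exp (s * (real n * \<epsilon>))"
    using int_exp[of s "\<lambda>i. i"] s by (intro integral_Markov_inequality_measure[where A = "{}"]) auto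
  also have "\<dots> \<le> exp u / exp (s * (real n * \<epsilon>))"
    using moment_sum by (simp add: divide_right_mono)
  also have "\<dots> = exp (2 * L * t) * exp (real n / real p * v - s * (real n * \<epsilon>))"
    by (simp add: u_def exp_add exp_diff)
  also have "\<dots> \<le> 4 * exp (- (1 / (8 * L\<^sup>2) * (\<epsilon>\<^sup>2 / real p)) * real n)"
  proof (rule mult_mono)
    have "2 * L * t \<le> 1"
      using True L by (simp add: t_def field_simps power2_eq_square)
    then have "exp (2 * L * t) \<le> exp 1" by simp
    also have "\<dots> \<le> 4" using exp_le by simp
    finally show "exp (2 * L * t) \<le> 4" .
    have "real n / real p * v - s * (real n * \<epsilon>) = - (5 / 32) * (real n * \<epsilon>\<^sup>2 / (L\<^sup>2 * real p))"
      using L p by (simp add: v s_def t_def field_simps power2_eq_square)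
    also have "\<dots> \<le> - (4 / 32) * (real n * \<epsilon>\<^sup>2 / (L\<^sup>2 * real p))"
      by (intro mult_right_mono) auto
    also have "\<dots> = - (1 / (8 * L\<^sup>2) * (\<epsilon>\<^sup>2 / real p)) * real n"
      by (simp add: field_simps)
    finally show "exp (real n / real p * v - s * (real n * \<epsilon>)) \<le> exp (- (1 / (8 * L\<^sup>2) * (\<epsilon>\<^sup>2 / real p)) * real n)"
      by simp
  qed auto
  finally show ?thesis .
qed

end


section \<open>Admissible spaces and mixing\<close>

lemma abs_le_sup_norm:
  assumes "f \<in> Linf"
  shows "\<bar>f x\<bar> \<le> sup_norm f"
proof -
  obtain B where "\<And>x. \<bar>f x\<bar> \<le> B" using Linf_bounded[OF assms] by blast
  then show ?thesis
    unfolding sup_norm_def by (intro cSUP_upper bdd_aboveI2[where M = B]) auto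
qed

lemma strongly_mixing_pointwise:
  assumes adm: "admissible K E N" and mix: "strongly_mixing K \<nu> E N r"
    and \<phi>: "\<phi> \<in> E" and n: "n \<ge> 1"
  shows "\<bar>(markov_op K ^^ n) \<phi> x - (\<integral>y. \<phi> y \<partial>\<nu>)\<bar> \<le> r n * N \<phi>"
proof -
  have "(markov_op K ^^ n) \<phi> \<in> E"
    using adm \<phi> by (induction n) (auto simp: admissible_def)
  then have Q: "(markov_op K ^^ n) \<phi> \<in> Linf" using adm by (auto simp: admissible_def)
  obtain B where B: "\<And>x. \<bar>(markov_op K ^^ n) \<phi> x\<bar> \<le> B" using Linf_bounded[OF Q] by blast
  have "\<bar>(markov_op K ^^ n) \<phi> x - c\<bar> \<le> B + \<bar>c\<bar>" for x c using B[of x] by linarith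
  then have "(\<lambda>x. (markov_op K ^^ n) \<phi> x - c) \<in> Linf" for c
    using Linf_measurable[OF Q] by (auto simp: Linf_def bounded_real)
  from abs_le_sup_norm[OF this] show ?thesis
    using mix \<phi> n unfolding strongly_mixing_def by (meson order_trans)
qed

text \<open>The lower tail of \<open>\<phi>\<close> is the upper tail of \<open>- \<phi>\<close>, which has the same norm and hence the
  same mixing time.\<close>

lemma two_sided_tail:
  fixes K :: "'a::polish_space \<Rightarrow> 'a measure"
  assumes sys: "markov_system K \<nu>" and adm: "admissible K E N"
    and mix: "strongly_mixing K \<nu> E N r" and chain: "markov_chain K P Z"
    and \<phi>: "\<phi> \<in> E" "N \<phi> > 0" and \<epsilon>: "\<epsilon> > 0"
    and p: "1 \<le> p" "p \<le> n" and rp: "r p \<le> \<epsilon> / (4 * N \<phi>)"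
  shows "measure P (deviation_set P Z \<nu> \<phi> \<epsilon> n) \<le> 8 * exp (- (1 / (8 * (N \<phi>)\<^sup>2) * (\<epsilon>\<^sup>2 / real p)) * real n)"
proof -
  interpret prob_space P using chain by (simp add: markov_chain_def)
  interpret kernel_chain P K Z
    using chain sys by unfold_locales
      (auto simp: markov_chain_def markov_system_def intro: markov_kernel_prob)
  note E = adm[unfolded admissible_def]
  have \<nu>: "\<nu> \<in> space (prob_algebra borel)" using sys by (simp add: markov_system_def)
  define m where "m = (\<integral>y. \<phi> y \<partial>\<nu>)"
  let ?c = "1 / (8 * (N \<phi>)\<^sup>2) * (\<epsilon>\<^sup>2 / real p)"
  let ?\<psi> = "\<lambda>x. - \<phi> x"
  have [measurable]: "\<phi> \<in> borel_measurable borel" using \<phi>(1) E Linf_measurable by blast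
  have \<psi>: "?\<psi> \<in> E" "N ?\<psi> = N \<phi>"
  proof -
    have "(\<lambda>x. (-1) * \<phi> x) \<in> E" "N (\<lambda>x. (-1) * \<phi> x) = \<bar>-1\<bar> * N \<phi>"
      using E \<phi>(1) unfolding banach_function_space_def by blast+
    then show "?\<psi> \<in> E" "N ?\<psi> = N \<phi>" by simp_all
  qed
  have \<phi>_le: "\<bar>\<phi> x\<bar> \<le> N \<phi>" for x
    using E \<phi>(1) abs_le_sup_norm[of \<phi> x] by force
  have m: "\<bar>m\<bar> \<le> N \<phi>"
    unfolding m_def using \<phi>(1) \<phi>_le E by (intro abs_integral_le[OF \<nu>]) auto
  have "r p * N \<phi> \<le> \<epsilon> / 4" using rp \<phi>(2) by (simp add: field_simps)
  then have "\<bar>(markov_op K ^^ p) \<phi> x - m\<bar> \<le> \<epsilon> / 4" "\<bar>(markov_op K ^^ p) ?\<psi> x + m\<bar> \<le> \<epsilon> / 4" for x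
    using strongly_mixing_pointwise[OF adm mix \<phi>(1) p(1), of x]
      strongly_mixing_pointwise[OF adm mix \<psi>(1) p(1), of x] \<psi>(2) by (auto simp: m_def)
  then have Q: "(markov_op K ^^ p) \<phi> x \<le> m + \<epsilon> / 4" "(markov_op K ^^ p) ?\<psi> x \<le> - m + \<epsilon> / 4" for x
    by (smt (verit))+
  have EL: "E \<subseteq> Linf" "\<And>f. f \<in> E \<Longrightarrow> markov_op K f \<in> E" using E by auto
  have "prob {\<omega> \<in> space P. birkhoff_sum Z \<phi> n \<omega> / real n - m > \<epsilon>} \<le> 4 * exp (- ?c * real n)"
    by (rule upper_tail[OF EL \<phi>(1) \<phi>_le \<phi>(2) m \<epsilon> Q(1) p])
  moreover have "prob {\<omega> \<in> space P. birkhoff_sum Z ?\<psi> n \<omega> / real n - (- m) > \<epsilon>} \<le> 4 * exp (- ?c * real n)"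
    by (rule upper_tail[OF EL \<psi>(1) _ \<phi>(2) _ \<epsilon> Q(2) p]) (use \<phi>_le m in auto)
  moreover have "prob (deviation_set P Z \<nu> \<phi> \<epsilon> n) \<le>
      prob ({\<omega> \<in> space P. birkhoff_sum Z \<phi> n \<omega> / real n - m > \<epsilon>} \<union>
        {\<omega> \<in> space P. birkhoff_sum Z ?\<psi> n \<omega> / real n - (- m) > \<epsilon>})"
  proof (rule finite_measure_mono)
    show "deviation_set P Z \<nu> \<phi> \<epsilon> n \<subseteq> {\<omega> \<in> space P. birkhoff_sum Z \<phi> n \<omega> / real n - m > \<epsilon>} \<union>
        {\<omega> \<in> space P. birkhoff_sum Z ?\<psi> n \<omega> / real n - (- m) > \<epsilon>}"
      by (auto simp: deviation_set_def birkhoff_sum_def m_def sum_negf)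
  qed (unfold birkhoff_sum_def, measurable)
  moreover have "\<dots> \<le> prob {\<omega> \<in> space P. birkhoff_sum Z \<phi> n \<omega> / real n - m > \<epsilon>} +
      prob {\<omega> \<in> space P. birkhoff_sum Z ?\<psi> n \<omega> / real n - (- m) > \<epsilon>}"
    unfolding birkhoff_sum_def by (rule measure_Un_le) measurable
  ultimately show ?thesis by linarith
qed

lemma mixing_time_properties:
  assumes "mixing_rate r" and "L > 0" and "\<epsilon> > 0"
  shows "\<exists>n\<ge>1. r n \<le> \<epsilon> / (4 * L)" and "mixing_time r L \<epsilon> \<ge> 1"
    and "r (mixing_time r L \<epsilon>) \<le> \<epsilon> / (4 * L)"
proof -
  have "\<forall>\<^sub>F n in sequentially. r n < \<epsilon> / (4 * L)"
    using assms by (intro order_tendstoD(2)[where y = 0]) (auto simp: mixing_rate_def)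
  then obtain n0 where n0: "\<And>n. n \<ge> n0 \<Longrightarrow> r n < \<epsilon> / (4 * L)"
    unfolding eventually_sequentially by blast
  then have n: "max 1 n0 \<ge> 1 \<and> r (max 1 n0) \<le> \<epsilon> / (4 * L)"
    using less_imp_le[OF n0[of "max 1 n0"]] by simp
  then show "\<exists>n\<ge>1. r n \<le> \<epsilon> / (4 * L)" by blast
  show "mixing_time r L \<epsilon> \<ge> 1" "r (mixing_time r L \<epsilon>) \<le> \<epsilon> / (4 * L)"
    using LeastI[where P = "\<lambda>n. n \<ge> 1 \<and> r n \<le> \<epsilon> / (4 * L)", OF n] unfolding mixing_time_def by auto
qed

theorem theorem1p1:
  fixes K :: "'a::polish_space \<Rightarrow> 'a measure"
    and \<nu> :: "'a measure"
    and E :: "('a \<Rightarrow> real) set"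
    and N :: "('a \<Rightarrow> real) \<Rightarrow> real"
    and r :: "nat \<Rightarrow> real"
    and P :: "'a \<Rightarrow> 'w measure"
    and Z :: "nat \<Rightarrow> 'w \<Rightarrow> 'a"
  assumes "markov_system K \<nu>"
    and "admissible K E N"
    and "strongly_mixing K \<nu> E N r"
    and "\<And>x0. markov_chain_from K x0 (P x0) Z"
  shows "\<forall>\<phi>\<in>E. \<forall>\<epsilon>>0.
    (\<exists>c>0. \<exists>n1::nat. n1 \<ge> 1 \<and>
       (\<forall>n\<ge>n1. \<forall>x0. measure (P x0) (deviation_set (P x0) Z \<nu> \<phi> \<epsilon> n) \<le> 8 * exp (- c * real n))) \<and>
    (\<phi> \<noteq> (\<lambda>_. 0) \<longrightarrow>
       (\<exists>n\<ge>1. r n \<le> \<epsilon> / (4 * N \<phi>)) \<and>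
       (let n1 = mixing_time r (N \<phi>) \<epsilon>;
            c = 1 / (8 * (N \<phi>)\<^sup>2) * (\<epsilon>\<^sup>2 / real n1)
        in c > 0 \<and> n1 \<ge> 1 \<and>
           (\<forall>n\<ge>n1. \<forall>x0. measure (P x0) (deviation_set (P x0) Z \<nu> \<phi> \<epsilon> n) \<le> 8 * exp (- c * real n))))"
proof (intro ballI allI impI)
  fix \<phi> and \<epsilon> :: real
  assume \<phi>: "\<phi> \<in> E" and \<epsilon>: "\<epsilon> > 0"
  let ?bound = "\<lambda>c n1::nat. \<forall>n\<ge>n1. \<forall>x0. measure (P x0) (deviation_set (P x0) Z \<nu> \<phi> \<epsilon> n) \<le> 8 * exp (- c * real n)"
  let ?n1 = "mixing_time r (N \<phi>) \<epsilon>"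
  let ?c = "1 / (8 * (N \<phi>)\<^sup>2) * (\<epsilon>\<^sup>2 / real ?n1)"
  have explicit: "(\<exists>n\<ge>1. r n \<le> \<epsilon> / (4 * N \<phi>)) \<and> ?c > 0 \<and> ?n1 \<ge> 1 \<and> ?bound ?c ?n1"
    if "\<phi> \<noteq> (\<lambda>_. 0)"
  proof -
    have N: "N \<phi> > 0"
      using assms(2) \<phi> that unfolding admissible_def banach_function_space_def
      by (metis less_eq_real_def)
    have "mixing_rate r" using assms(3) by (simp add: strongly_mixing_def)
    note n1 = mixing_time_properties[OF this N \<epsilon>]
    have "?bound ?c ?n1"
    proof (intro allI impI)
      fix n x0
      assume "?n1 \<le> n"
      then show "measure (P x0) (deviation_set (P x0) Z \<nu> \<phi> \<epsilon> n) \<le> 8 * exp (- ?c * real n)"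
        using two_sided_tail[OF assms(1-3) _ \<phi> N \<epsilon> n1(2) _ n1(3)] assms(4)
        unfolding markov_chain_from_def by blast
    qed
    moreover have "?c > 0" using N \<epsilon> n1(2) by simp
    ultimately show ?thesis using n1 by blast
  qed
  show "(\<exists>c>0. \<exists>n1\<ge>1. ?bound c n1) \<and>
    (\<phi> \<noteq> (\<lambda>_. 0) \<longrightarrow> (\<exists>n\<ge>1. r n \<le> \<epsilon> / (4 * N \<phi>)) \<and>
      (let n1 = ?n1; c = 1 / (8 * (N \<phi>)\<^sup>2) * (\<epsilon>\<^sup>2 / real n1) in c > 0 \<and> n1 \<ge> 1 \<and> ?bound c n1))"
  proof (cases "\<phi> = (\<lambda>_. 0)")
    case True
    then have "deviation_set (P x0) Z \<nu> \<phi> \<epsilon> n = {}" for x0 n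
      using \<epsilon> by (simp add: deviation_set_def birkhoff_sum_def)
    then have "?bound 1 1" by simp
    then show ?thesis using True zero_less_one by blast
  next
    case False
    then show ?thesis using explicit unfolding Let_def by blast
  qed
qed

end
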